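(* Let $S$ be a finite group, $p$ a prime, and $A$ a normal subgroup of $S$ of index $p$. Let $H \leq A$ and let $t \in S \setminus A$. Then \[ [H]_{S} = [H]_{A} \cup [H^{t}]_{A} \cup \cdots \cup [H^{t^{p-1}}]_{A}, \] where either $[H]_{S} = [H]_{A}$ and $|N_{S}(H) : N_{A}(H)| = p$, or $N_{S}(H) = N_{A}(H)$ and $|[H]_{S}| = p\,|[H]_{A}|$.
   Context: For a subgroup $H$ of $S$ and $s \in S$, $H^{s} = s^{-1}Hs$. For a subgroup $G \leq S$, $[H]_{G} = \{H^{g} : g \in G\}$ is the $G$-conjugacy class of $H$, and $N_G(H) = \{g \in G : H^g = H\}$. *)

theory Defs
  imports "HOL-Algebra.Algebra"
begin

(* Throughout, S is the ambient group and G (the carrier of) a subgroup of S.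
   Conjugation is on the right: H^s = s^{-1} H s. *)

definition conj_set :: "('a, 'b) monoid_scheme \<Rightarrow> 'a set \<Rightarrow> 'a \<Rightarrow> 'a set"
  where "conj_set S H s = inv\<^bsub>S\<^esub> s <#\<^bsub>S\<^esub> H #>\<^bsub>S\<^esub> s"

definition conj_class :: "('a, 'b) monoid_scheme \<Rightarrow> 'a set \<Rightarrow> 'a set \<Rightarrow> 'a set set"
  where "conj_class S G H = {conj_set S H g | g. g \<in> G}"

(* HOL-Algebra's normalizer is relative to the whole carrier and conjugates on the left;
   normalizer_in_eq relates the two. *)
definition normalizer_in :: "('a, 'b) monoid_scheme \<Rightarrow> 'a set \<Rightarrow> 'a set \<Rightarrow> 'a set"
  where "normalizer_in S G H = {g \<in> G. conj_set S H g = H}"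

definition index_in :: "('a, 'b) monoid_scheme \<Rightarrow> 'a set \<Rightarrow> 'a set \<Rightarrow> nat"
  where "index_in S K L = card (rcosets\<^bsub>S\<lparr>carrier := K\<rparr>\<^esub> L)"

lemma normalizer_in_eq:
  assumes "group S" and G: "subgroup G S" and H: "H \<subseteq> carrier S"
  shows "normalizer_in S G H = G \<inter> normalizer S H"
proof -
  interpret group S by fact
  have "inv\<^bsub>S\<^esub> g <#\<^bsub>S\<^esub> H #>\<^bsub>S\<^esub> g = H \<longleftrightarrow> g <#\<^bsub>S\<^esub> H #>\<^bsub>S\<^esub> inv\<^bsub>S\<^esub> g = H"
    if g: "g \<in> carrier S" for g
  proof -
    have *: "inv\<^bsub>S\<^esub> x <#\<^bsub>S\<^esub> (x <#\<^bsub>S\<^esub> H #>\<^bsub>S\<^esub> inv\<^bsub>S\<^esub> x) #>\<^bsub>S\<^esub> x = H" if x: "x \<in> carrier S" for x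
      using x H
      by (simp add: coset_assoc coset_mult_assoc coset_mult_one l_coset_subset_G lcos_m_assoc
          lcos_mult_one r_coset_subset_G)
    show ?thesis
      using *[OF g] *[of "inv\<^bsub>S\<^esub> g"] g by (metis inv_closed inv_inv)
  qed
  then show ?thesis
    using H subgroup.subset[OF G]
    unfolding normalizer_in_def conj_set_def normalizer_def stabilizer_def
    by auto
qed

end

theory Submission
  imports Defs
begin

(* A set-theoretic orbit-stabilizer count gives |[H]_G| |N_G(H)| = |G| for G = S and G = A.
   As S/A has prime order, it is generated by the image of any element outside A, so
   S is the union of the cosets t^i A, which yields the decomposition of [H]_S. If N_S(H)
   lies in A the count yields the second alternative. Otherwise, some n outside A
   normalizes H, and taking n for t shows [H]_S = [H]_A. *)

context group
begin

lemma conj_set_mult: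
  assumes "H \<subseteq> carrier G" "x \<in> carrier G" "y \<in> carrier G"
  shows "conj_set G (conj_set G H x) y = conj_set G H (x \<otimes> y)"
  using assms
  by (simp add: conj_set_def coset_assoc coset_mult_assoc l_coset_subset_G lcos_m_assoc
      r_coset_subset_G inv_mult_group)

lemma conj_set_one:
  assumes "H \<subseteq> carrier G"
  shows "conj_set G H \<one> = H"
  using assms by (simp add: conj_set_def coset_mult_one lcos_mult_one)

text \<open>Conjugation is a right action, so two conjugates agree exactly when the quotient
  \<open>x \<otimes> inv y\<close> stabilizes \<open>H\<close>. This identifies the fibres of the
  orbit map with right cosets of the normalizer.\<close>

lemma conj_set_eq_iff:
  assumes H: "H \<subseteq> carrier G" and x: "x \<in> carrier G" and y: "y \<in> carrier G"
  shows "conj_set G H x = conj_set G H y \<longleftrightarrow> conj_set G H (x \<otimes> inv y) = H"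
proof
  assume "conj_set G H x = conj_set G H y"
  then have "conj_set G (conj_set G H x) (inv y) = conj_set G (conj_set G H y) (inv y)"
    by simp
  then show "conj_set G H (x \<otimes> inv y) = H"
    using assms by (simp add: conj_set_mult conj_set_one)
next
  assume "conj_set G H (x \<otimes> inv y) = H"
  then have "conj_set G (conj_set G H (x \<otimes> inv y)) y = conj_set G H y"
    by simp
  then show "conj_set G H x = conj_set G H y"
    using assms by (simp add: conj_set_mult m_assoc)
qed

lemma conj_set_pow:
  assumes "H \<subseteq> carrier G" "x \<in> carrier G" "conj_set G H x = H"
  shows "conj_set G H (x [^] (i::nat)) = H"
proof (induction i)
  case 0
  then show ?case using assms by (simp add: conj_set_one)
next
  case (Suc i)
  then show ?case using assms conj_set_mult[of H "x [^] i" x] by simp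
qed

lemma subgroup_normalizer_in:
  assumes K: "subgroup K G" and H: "H \<subseteq> carrier G"
  shows "subgroup (normalizer_in G K H) G"
proof (rule subgroupI)
  note carr = subgroup.mem_carrier[OF K]
  show "normalizer_in G K H \<subseteq> carrier G"
    using carr by (auto simp: normalizer_in_def)
  show "normalizer_in G K H \<noteq> {}"
    using subgroup.one_closed[OF K] conj_set_one[OF H] by (auto simp: normalizer_in_def)
  \<comment> \<open>Comparing the conjugates by \<open>\<one>\<close> and by \<open>x\<close> turns
    the claim into one about \<open>\<one> \<otimes> inv x\<close>.\<close>
  show "inv x \<in> normalizer_in G K H" if "x \<in> normalizer_in G K H" for x
    using that conj_set_eq_iff[OF H one_closed, of x] carr[of x] subgroup.m_inv_closed[OF K, of x]
    by (auto simp: normalizer_in_def conj_set_one H)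
  show "x \<otimes> y \<in> normalizer_in G K H"
    if "x \<in> normalizer_in G K H" "y \<in> normalizer_in G K H" for x y
    using that conj_set_mult[OF H, of x y] carr subgroup.m_closed[OF K, of x y]
    by (auto simp: normalizer_in_def)
qed

text \<open>The fibres of the map from \<open>g\<close> in \<open>K\<close> to the conjugate of
  \<open>H\<close> by \<open>g\<close> all have the size of the normalizer; adding them up over the
  class counts \<open>K\<close>.\<close>

lemma card_conj_class_mult_normalizer_in:
  assumes K: "subgroup K G" and fin: "finite K" and H: "H \<subseteq> carrier G"
  shows "card (conj_class G K H) * card (normalizer_in G K H) = card K"
proof -
  note carr = subgroup.mem_carrier[OF K]
  let ?N = "normalizer_in G K H"
  have fibre: "card {g \<in> K. conj_set G H g = C} = card ?N" if "C \<in> conj_class G K H" for C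
  proof -
    obtain x where x: "x \<in> K" "C = conj_set G H x"
      using \<open>C \<in> conj_class G K H\<close> by (auto simp: conj_class_def)
    \<comment> \<open>The fibre over \<open>C\<close> is the right coset of \<open>?N\<close>
      through \<open>x\<close>, so right translation by \<open>inv x\<close> carries it onto
      \<open>?N\<close>.\<close>
    have "bij_betw (\<lambda>g. g \<otimes> inv x) {g \<in> K. conj_set G H g = C} ?N"
      by (rule bij_betwI[where g = "\<lambda>n. n \<otimes> x"])
        (use x in \<open>auto simp: normalizer_in_def carr m_assoc conj_set_eq_iff[OF H]
          subgroup.m_closed[OF K] subgroup.m_inv_closed[OF K]\<close>)
    then show ?thesis by (rule bij_betw_same_card)
  qed
  have image: "conj_class G K H = conj_set G H ` K"
    by (auto simp: conj_class_def)
  have "card K = (\<Sum>C\<in>conj_class G K H. card {g \<in> K. conj_set G H g = C})"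
    using sum.group[OF fin, of "conj_class G K H" "conj_set G H" "\<lambda>_. 1::nat"] fin image
    by simp
  then show ?thesis
    using fibre by simp
qed

lemma index_in_mult_card:
  assumes K: "subgroup K G" and L: "subgroup L G" and "L \<subseteq> K"
  shows "index_in G K L * card L = card K"
  using group.lagrange[OF subgroup.subgroup_is_group[OF K is_group] subgroup_incl[OF L K \<open>L \<subseteq> K\<close>]]
  by (simp add: index_in_def order_def)

text \<open>In a group of prime order every nontrivial element generates, so powers of
  \<open>t\<close> represent all cosets of \<open>N\<close>. Leaving \<open>t\<close> arbitrary
  outside \<open>N\<close> allows a later choice of an element that normalizes
  \<open>H\<close>.\<close>

lemma prime_index_factorization:
  assumes N: "N \<lhd> G"
    and p: "Factorial_Ring.prime (card (rcosets N))"
    and t: "t \<in> carrier G" "t \<notin> N" and s: "s \<in> carrier G"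
  obtains i a where "i < card (rcosets N)" "a \<in> N" "s = t [^] (i::nat) \<otimes> a"
proof -
  interpret N: normal N G by fact
  interpret Q: group "G Mod N" by (rule N.factorgroup_is_group)
  interpret h: group_hom G "G Mod N" "(#>) N"
    by (simp add: group_hom_def group_hom_axioms_def Q.is_group N.r_coset_hom_Mod)
  have carQ: "carrier (G Mod N) = rcosets N"
    by (simp add: FactGroup_def)
  \<comment> \<open>An infinite set has \<open>card\<close> equal to 0, which is not prime.\<close>
  have finQ: "finite (carrier (G Mod N))"
    using p carQ by (metis card.infinite not_prime_0)
  have tQ: "N #> t \<in> carrier (G Mod N)"
    using t by simp
  have "N #> t \<noteq> N"
    using t rcos_self[OF t(1) N.is_subgroup] by auto
  then have "Q.ord (N #> t) \<noteq> 1"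
    using Q.ord_eq_1[OF tQ] by simp
  moreover have "Q.ord (N #> t) dvd card (rcosets N)"
    using Q.ord_dvd_group_order[OF tQ] carQ by (simp add: order_def)
  ultimately have ord: "Q.ord (N #> t) = card (rcosets N)"
    using p prime_nat_iff by blast
  \<comment> \<open>These powers are pairwise distinct and as many as the elements of the quotient,
    so they exhaust it.\<close>
  let ?P = "(\<lambda>i. (N #> t) [^]\<^bsub>G Mod N\<^esub> i) ` {0..Q.ord (N #> t) - 1}"
  have "card ?P = card (carrier (G Mod N))"
    using card_image[OF Q.ord_inj[OF tQ]] ord carQ prime_gt_0_nat[OF p] by simp
  moreover have "?P \<subseteq> carrier (G Mod N)"
    using tQ by auto
  ultimately have "?P = carrier (G Mod N)"
    using finQ card_subset_eq by blast
  moreover have "N #> s \<in> carrier (G Mod N)"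
    using s by simp
  ultimately have "N #> s \<in> ?P"
    by (simp only:)
  then obtain i where i: "i \<le> card (rcosets N) - 1" "N #> s = (N #> t) [^]\<^bsub>G Mod N\<^esub> i"
    unfolding ord by (meson atLeastAtMost_iff imageE)
  \<comment> \<open>Normality turns the right coset into a left one, which puts the factor from
    \<open>N\<close> to the right of the power of \<open>t\<close>, where it acts last in
    conjugation.\<close>
  have "N #> s = t [^] i <# N"
    using i t h.hom_nat_pow[of t i] N.coset_eq by simp
  then have "s \<in> t [^] i <# N"
    using rcos_self[OF s N.is_subgroup] by simp
  then obtain a where "a \<in> N" "s = t [^] i \<otimes> a"
    by (auto simp: l_coset_def)
  moreover have "i < card (rcosets N)"
    using i prime_gt_0_nat[OF p] by linarith
  ultimately show ?thesis
    using that by blast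
qed

end

theorem proposition3p1:
  fixes S :: "('a, 'b) monoid_scheme" and A H :: "'a set" and t :: 'a and p :: nat
  assumes "group S" and "finite (carrier S)"
    and "Factorial_Ring.prime p"
    and "A \<lhd> S" and "index_in S (carrier S) A = p"
    and "subgroup H S" and "H \<subseteq> A"
    and "t \<in> carrier S - A"
  shows "conj_class S (carrier S) H =
             conj_class S A H \<union> (\<Union>i\<in>{1..p-1}. conj_class S A (conj_set S H (t [^]\<^bsub>S\<^esub> i)))
         \<and> ((conj_class S (carrier S) H = conj_class S A H \<and>
               index_in S (normalizer_in S (carrier S) H) (normalizer_in S A H) = p) \<or>
            (normalizer_in S (carrier S) H = normalizer_in S A H \<and>
               card (conj_class S (carrier S) H) = p * card (conj_class S A H)))
         \<and> \<not> ((conj_class S (carrier S) H = conj_class S A H \<and>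
                 index_in S (normalizer_in S (carrier S) H) (normalizer_in S A H) = p) \<and>
              (normalizer_in S (carrier S) H = normalizer_in S A H \<and>
                 card (conj_class S (carrier S) H) = p * card (conj_class S A H)))"
proof -
  interpret group S by fact
  interpret A: normal A S by fact
  note fin = assms(2) and p = assms(3)
  have t: "t \<in> carrier S" "t \<notin> A"
    using assms(8) by auto
  have H: "H \<subseteq> carrier S"
    using subgroup.subset[OF assms(6)] .
  have index: "card (rcosets\<^bsub>S\<^esub> A) = p"
    using assms(5) by (simp add: index_in_def)
  note factor = prime_index_factorization[OF assms(4), unfolded index, OF p]
  let ?CS = "conj_class S (carrier S) H" and ?CA = "conj_class S A H"
  let ?NS = "normalizer_in S (carrier S) H" and ?NA = "normalizer_in S A H"
  have conj_A: "conj_class S A (conj_set S H x) = {conj_set S H (x \<otimes>\<^bsub>S\<^esub> a) | a. a \<in> A}"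
    if "x \<in> carrier S" for x
    using that by (force simp: conj_class_def conj_set_mult[OF H] A.mem_carrier)
  have "?CS \<subseteq> ?CA \<union> (\<Union>i\<in>{1..p-1}. conj_class S A (conj_set S H (t [^]\<^bsub>S\<^esub> i)))"
  proof
    fix C assume "C \<in> ?CS"
    then obtain s where s: "s \<in> carrier S" "C = conj_set S H s"
      by (auto simp: conj_class_def)
    obtain i a where ia: "i < p" "a \<in> A" "s = t [^]\<^bsub>S\<^esub> (i::nat) \<otimes>\<^bsub>S\<^esub> a"
      using factor[OF t s(1)] .
    show "C \<in> ?CA \<union> (\<Union>i\<in>{1..p-1}. conj_class S A (conj_set S H (t [^]\<^bsub>S\<^esub> i)))"
    \<comment> \<open>The exponent 0 gives the class of \<open>H\<close> itself, which the union
      lists separately.\<close>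
    proof (cases "i = 0")
      case True
      then show ?thesis using s ia by (auto simp: conj_class_def A.mem_carrier)
    next
      case False
      then have "i \<in> {1..p-1}" using ia by auto
      moreover have "C \<in> conj_class S A (conj_set S H (t [^]\<^bsub>S\<^esub> i))"
        using s ia t by (auto simp: conj_A)
      ultimately show ?thesis by blast
    qed
  qed
  moreover have CA_CS: "?CA \<subseteq> ?CS"
    using A.subset by (auto simp: conj_class_def)
  moreover have "conj_class S A (conj_set S H (t [^]\<^bsub>S\<^esub> i)) \<subseteq> ?CS" for i :: nat
    using t A.subset by (subst conj_A) (auto simp: conj_class_def)
  ultimately have union:
    "?CS = ?CA \<union> (\<Union>i\<in>{1..p-1}. conj_class S A (conj_set S H (t [^]\<^bsub>S\<^esub> i)))"
    by blast
  have card_S: "card (carrier S) = p * card A"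
    using lagrange[OF A.is_subgroup] index by (simp add: order_def)
  have NA: "?NA = ?NS \<inter> A" "subgroup ?NA S"
    using A.subset subgroup_normalizer_in[OF A.is_subgroup H] by (auto simp: normalizer_in_def)
  have NS: "subgroup ?NS S"
    using subgroup_normalizer_in[OF subgroup_self H] .
  have orbit_S: "card ?CS * card ?NS = p * card A"
    using card_conj_class_mult_normalizer_in[OF subgroup_self fin H] card_S by simp
  have orbit_A: "card ?CA * card ?NA = card A"
    using card_conj_class_mult_normalizer_in[OF A.is_subgroup _ H] fin A.subset finite_subset
    by blast
  have pos: "card A > 0"
    using A.subset A.one_closed fin by (metis card_gt_0_iff empty_iff finite_subset)
  \<comment> \<open>Both are factors of the positive number \<open>card A\<close>; this permits the
    cancellations below.\<close>
  have posN: "card ?NA > 0" and posC: "card ?CA > 0"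
    using orbit_A pos by (auto intro: Nat.gr0I)
  have index_N: "index_in S ?NS ?NA * card ?NA = card ?NS"
    using index_in_mult_card[OF NS NA(2)] NA(1) by blast
  have alternatives: "(?CS = ?CA \<and> index_in S ?NS ?NA = p) \<or>
      (?NS = ?NA \<and> card ?CS = p * card ?CA)"
  proof (cases "?NS \<subseteq> A")
    case True
    then have eq: "?NS = ?NA" using NA by blast
    \<comment> \<open>With equal normalizers, the two orbit counts differ by the factor
      \<open>p\<close> only, which must come from the classes.\<close>
    then have "card ?CS * card ?NA = p * card ?CA * card ?NA"
      using orbit_S orbit_A by (simp add: ac_simps)
    then show ?thesis using eq posN by simp
  next
    case False
    \<comment> \<open>Here \<open>n\<close> replaces \<open>t\<close>: its powers fix
      \<open>H\<close>, so conjugating by a power of \<open>n\<close> times \<open>a\<close> is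
      conjugating by \<open>a\<close> alone.\<close>
    then obtain n where n: "n \<in> carrier S" "n \<notin> A" "conj_set S H n = H"
      by (auto simp: normalizer_in_def)
    have "?CS \<subseteq> ?CA"
    proof
      fix C assume "C \<in> ?CS"
      then obtain s where s: "s \<in> carrier S" "C = conj_set S H s"
        by (auto simp: conj_class_def)
      obtain i a where ia: "a \<in> A" "s = n [^]\<^bsub>S\<^esub> (i::nat) \<otimes>\<^bsub>S\<^esub> a"
        using factor[OF n(1,2) s(1)] by metis
      have "C = conj_set S H a"
        using s ia n conj_set_mult[OF H, of "n [^]\<^bsub>S\<^esub> i" a] conj_set_pow[OF H n(1,3)]
        by (simp add: A.mem_carrier)
      then show "C \<in> ?CA" using ia by (auto simp: conj_class_def)
    qed
    then have eq: "?CS = ?CA" using CA_CS by blast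
    \<comment> \<open>With equal classes, the factor \<open>p\<close> between the two orbit counts
      must be the index of the normalizers.\<close>
    have "card ?CA * (index_in S ?NS ?NA * card ?NA) = p * (card ?CA * card ?NA)"
      using orbit_S by (simp only: index_N orbit_A eq)
    then have "index_in S ?NS ?NA = p" using posC posN by simp
    then show ?thesis using eq by blast
  qed
  \<comment> \<open>The alternatives exclude each other: a positive number is not \<open>p\<close>
    times itself when \<open>p\<close> exceeds 1.\<close>
  have "\<not> (?CS = ?CA \<and> card ?CS = p * card ?CA)"
    using posC prime_gt_1_nat[OF p] by auto
  then show ?thesis
    using union alternatives by blast
qed

end
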